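(* Let $\varepsilon\in(0,1)$, let $f:X\to X$ be a Borel measurable map, non-singular with respect to $m$, and consider its randomly applied stochastic perturbation with stationary measure $\mu_\varepsilon=h_\varepsilon m$ as described in the context. If $\phi\in L^\infty$ and $\psi\in L^1\cap L^\infty$, then for every $n\in\mathbb{N}$ $$\left|\int\int \phi(f^n_{\underline\omega}(x))\,\psi(x)\,d\mu_\varepsilon(x)\, d\theta_\varepsilon^{\mathbb{N}}(\underline\omega)-\int\phi\,d\mu_\varepsilon\int\psi\,d\mu_\varepsilon\right|\leq 2(1-\varepsilon)^n\,\|\phi\|_{L^\infty}\,\|\psi h_\varepsilon\|_{L^1}.$$
   Context: $X\subset\mathbb{R}^D$ is compact, $m$ is the normalized Lebesgue measure on $X$ ($m(X)=1$), and $L^1,L^\infty$ are taken with respect to $m$. Randomly applied stochastic perturbation. Let $\Omega_\varepsilon=\{0,1\}\times X$ and let $\theta_\varepsilon$ be the product of the Bernoulli measure with weights $(\varepsilon,1-\varepsilon)$ on $\{0,1\}$ (so $0$ has probability $\varepsilon$) and the uniform measure $m$ on $X$. For $\omega=(\eta,\xi)\in\Omega_\varepsilon$ put $f_\omega(x)=\eta f(x)+(1-\eta)\xi$. For $\underline\omega=(\omega_1,\omega_2,\dots)\in\Omega_\varepsilon^{\mathbb{N}}$ put $f^0_{\underline\omega}(x)=x$ and $f^n_{\underline\omega}(x)=f_{\omega_n}\circ\cdots\circ f_{\omega_1}(x)$. The stationary measure is $\mu_\varepsilon=h_\varepsilon m$ with $h_\varepsilon=\varepsilon\sum_{k=0}^\infty(1-\varepsilon)^kP^k\mathbf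 1$, where $P:L^1\to L^1$ is the transfer (Perron-Frobenius) operator of $f$, defined by $\int\phi\,P\psi\,dm=\int(\phi\circ f)\,\psi\,dm$ for $\phi\in L^\infty,\psi\in L^1$. It satisfies $\int\phi\,d\mu_\varepsilon=\int\int\phi(f_\omega(x))\,d\theta_\varepsilon(\omega)\,d\mu_\varepsilon(x)$ for all $\phi\in L^\infty$. *)

theory Defs
  imports "HOL-Probability.Probability"
begin

text \<open>Normalized Lebesgue measure, as a measure on the Lebesgue measurable subsets of \<open>X\<close>.\<close>

definition norm_lebesgue :: "'a::euclidean_space set \<Rightarrow> 'a measure" where
  "norm_lebesgue X = uniform_measure (lebesgue_on X) X"

definition Linf :: "'a measure \<Rightarrow> ('a \<Rightarrow> real) set" where
  "Linf M = {\<phi> \<in> borel_measurable M. esssup M (\<lambda>x. ereal \<bar>\<phi> x\<bar>) < \<infinity>}"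

definition Linf_norm :: "'a measure \<Rightarrow> ('a \<Rightarrow> real) \<Rightarrow> real" where
  "Linf_norm M \<phi> = real_of_ereal (esssup M (\<lambda>x. ereal \<bar>\<phi> x\<bar>))"

definition L1_norm :: "'a measure \<Rightarrow> ('a \<Rightarrow> real) \<Rightarrow> real" where
  "L1_norm M \<psi> = (\<integral>x. \<bar>\<psi> x\<bar> \<partial>M)"

text \<open>Asking for membership in \<^term>\<open>null_sets M\<close>, rather than \<^term>\<open>emeasure M\<close> being zero,
  avoids the convention that \<^term>\<open>emeasure M\<close> vanishes on non-measurable sets.\<close>

definition nonsingular :: "'a measure \<Rightarrow> ('a \<Rightarrow> 'a) \<Rightarrow> bool" where
  "nonsingular M f \<longleftrightarrow> (\<forall>A\<in>null_sets M. f -` A \<inter> space M \<in> null_sets M)"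

text \<open>The duality relation determines \<open>P \<psi>\<close> only almost everywhere; \<open>transfer_op\<close> picks some
  representative. Such a function exists, by Radon-Nikodym, when \<open>f\<close> is measurable and
  non-singular and \<open>\<psi>\<close> is integrable.\<close>

definition transfer_op :: "'a measure \<Rightarrow> ('a \<Rightarrow> 'a) \<Rightarrow> ('a \<Rightarrow> real) \<Rightarrow> 'a \<Rightarrow> real" where
  "transfer_op M f \<psi> =
     (SOME g. integrable M g \<and>
        (\<forall>\<phi>\<in>Linf M. (\<integral>x. \<phi> x * g x \<partial>M) = (\<integral>x. \<phi> (f x) * \<psi> x \<partial>M)))"

text \<open>The value \<open>True\<close> stands for \<open>\<eta> = 1\<close> and has probability \<open>1 - \<epsilon>\<close>.\<close>

definition noise :: "real \<Rightarrow> 'a measure \<Rightarrow> (bool \<times> 'a) measure" where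
  "noise \<epsilon> M = measure_pmf (bernoulli_pmf (1 - \<epsilon>)) \<Otimes>\<^sub>M M"

definition noise_seq :: "real \<Rightarrow> 'a measure \<Rightarrow> (nat \<Rightarrow> bool \<times> 'a) measure" where
  "noise_seq \<epsilon> M = (\<Pi>\<^sub>M i\<in>(UNIV :: nat set). noise \<epsilon> M)"

fun perturbed :: "('a::real_vector \<Rightarrow> 'a) \<Rightarrow> bool \<times> 'a \<Rightarrow> 'a \<Rightarrow> 'a" where
  "perturbed f (\<eta>, \<xi>) x = of_bool \<eta> *\<^sub>R f x + (1 - of_bool \<eta>) *\<^sub>R \<xi>"

text \<open>Noise sequences are indexed from \<open>0\<close>, so \<open>\<omega> 0\<close> is applied first.\<close>

primrec random_iterate ::
    "('a::real_vector \<Rightarrow> 'a) \<Rightarrow> nat \<Rightarrow> (nat \<Rightarrow> bool \<times> 'a) \<Rightarrow> 'a \<Rightarrow> 'a" where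
  "random_iterate f 0 \<omega> x = x"
| "random_iterate f (Suc n) \<omega> x = perturbed f (\<omega> n) (random_iterate f n \<omega> x)"

text \<open>The series is summed pointwise. Its terms are non-negative almost everywhere with summable
  \<open>L\<^sup>1\<close>-norms, so this agrees almost everywhere with its sum in \<open>L\<^sup>1\<close>.\<close>

definition stationary_density :: "real \<Rightarrow> 'a measure \<Rightarrow> ('a \<Rightarrow> 'a) \<Rightarrow> 'a \<Rightarrow> real" where
  "stationary_density \<epsilon> M f x =
     \<epsilon> * (\<Sum>k. (1 - \<epsilon>) ^ k * (transfer_op M f ^^ k) (\<lambda>_. 1) x)"

definition stationary_measure :: "real \<Rightarrow> 'a measure \<Rightarrow> ('a \<Rightarrow> 'a) \<Rightarrow> 'a measure" where
  "stationary_measure \<epsilon> M f = density M (\<lambda>x. ennreal (stationary_density \<epsilon> M f x))"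

end

theory Submission
  imports Defs
begin

text \<open>
  At every time step the perturbed orbit either follows \<open>f\<close>, with probability \<open>1 - \<epsilon>\<close>, or restarts at a
  point chosen according to \<open>m\<close>. After a restart nothing is remembered of the initial point. Sorting
  the noise sequences by the time of the last restart among the first \<open>n\<close> steps therefore gives, for
  every initial point \<open>x\<close>, the average of \<open>\<phi>\<close> at time \<open>n\<close> as
  \<open>(1 - \<epsilon>) ^ n * \<phi> ((f ^^ n) x) + (\<Sum>k<n. \<epsilon> * (1 - \<epsilon>) ^ k * (\<integral>y. \<phi> ((f ^^ k) y) \<partial>m))\<close>
  (lemma \<open>integral_random_iterate\<close>).

  The stationary measure integrates \<open>\<phi>\<close> to the full series with these coefficients, by the duality that
  defines the transfer operator. Its tail from \<open>k = n\<close> on is the same series for \<open>\<phi> \<circ> f ^^ n\<close>,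
  multiplied by \<open>(1 - \<epsilon>) ^ n\<close> (lemma \<open>integral_stationary_density_split\<close>). Subtracting, the partial sums
  cancel, and what remains is the identity of lemma \<open>random_correlation_eq\<close>: the correlation at time
  \<open>n\<close> is exactly \<open>(1 - \<epsilon>) ^ n\<close> times the covariance of \<open>\<phi> \<circ> f ^^ n\<close> and \<open>\<psi>\<close> under the stationary
  measure. As \<open>f\<close> is non-singular, \<open>\<phi> \<circ> f ^^ n\<close> is essentially bounded by the norm of \<open>\<phi>\<close>, so each of
  the two terms of the covariance is at most the norm of \<open>\<phi>\<close> times the \<open>L\<^sup>1\<close>-norm of \<open>\<psi> h\<close>.

  The argument is carried out for a measurable non-singular map and any probability measure on a real
  vector space. To apply it to Lebesgue measure one checks that a non-singular Borel map is also Lebesgue measurable (lemma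
  \<open>measurable_norm_lebesgue\<close>).
\<close>

section \<open>Essentially bounded functions on a probability space\<close>

context prob_space
begin

lemma AE_le_Linf_norm:
  assumes "\<phi> \<in> Linf M"
  shows "AE x in M. \<bar>\<phi> x\<bar> \<le> Linf_norm M \<phi>"
proof -
  let ?s = "esssup M (\<lambda>x. ereal \<bar>\<phi> x\<bar>)"
  have "esssup M (\<lambda>x. 0 :: ereal) \<le> ?s"
    by (rule esssup_mono) auto
  then have "0 \<le> ?s"
    by (simp add: esssup_const emeasure_space_1)
  moreover have "?s < \<infinity>"
    using assms by (simp add: Linf_def)
  ultimately have s: "?s = ereal (Linf_norm M \<phi>)"
    unfolding Linf_norm_def by (cases ?s) auto
  have "AE x in M. ereal \<bar>\<phi> x\<bar> \<le> ?s"
    by (rule esssup_AE)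
  then show ?thesis
    unfolding s by simp
qed

lemma Linf_norm_nonneg:
  assumes "\<phi> \<in> Linf M"
  shows "0 \<le> Linf_norm M \<phi>"
proof -
  have "AE x in M. 0 \<le> Linf_norm M \<phi>"
    using AE_le_Linf_norm[OF assms] by eventually_elim linarith
  then show ?thesis
    by simp
qed

lemma LinfI:
  assumes "\<phi> \<in> borel_measurable M" and "AE x in M. \<bar>\<phi> x\<bar> \<le> C"
  shows "\<phi> \<in> Linf M"
proof -
  have "esssup M (\<lambda>x. ereal \<bar>\<phi> x\<bar>) \<le> ereal C"
    using assms by (intro esssup_I) auto
  then have "esssup M (\<lambda>x. ereal \<bar>\<phi> x\<bar>) < \<infinity>"
    by (rule le_less_trans) simp
  with assms show ?thesis
    by (simp add: Linf_def)
qed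

lemma Linf_measurable: "\<phi> \<in> Linf M \<Longrightarrow> \<phi> \<in> borel_measurable M"
  by (simp add: Linf_def)

lemma integrable_mult_Linf:
  assumes \<phi>: "\<phi> \<in> Linf M" and g: "integrable M g"
  shows "integrable M (\<lambda>x. \<phi> x * g x)"
proof (rule Bochner_Integration.integrable_bound)
  show "integrable M (\<lambda>x. Linf_norm M \<phi> * g x)"
    using g by simp
  show "(\<lambda>x. \<phi> x * g x) \<in> borel_measurable M"
    using Linf_measurable[OF \<phi>] g by auto
  show "AE x in M. norm (\<phi> x * g x) \<le> norm (Linf_norm M \<phi> * g x)"
    using AE_le_Linf_norm[OF \<phi>]
    by eventually_elim (auto simp: abs_mult intro!: mult_right_mono)
qed

lemma abs_integral_mult_Linf_le:
  assumes \<phi>: "\<phi> \<in> Linf M" and g: "integrable M g"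
    and C: "AE x in M. \<bar>\<phi> x\<bar> \<le> C"
  shows "\<bar>\<integral>x. \<phi> x * g x \<partial>M\<bar> \<le> C * L1_norm M g"
proof -
  have "\<bar>\<integral>x. \<phi> x * g x \<partial>M\<bar> \<le> (\<integral>x. \<bar>\<phi> x * g x\<bar> \<partial>M)"
    by (rule integral_abs_bound)
  also have "\<dots> \<le> (\<integral>x. C * \<bar>g x\<bar> \<partial>M)"
  proof (rule integral_mono_AE)
    show "AE x in M. \<bar>\<phi> x * g x\<bar> \<le> C * \<bar>g x\<bar>"
      using C by eventually_elim (auto simp: abs_mult intro!: mult_right_mono)
  qed (use g integrable_mult_Linf[OF \<phi> g] in auto)
  finally show ?thesis
    by (simp add: L1_norm_def)
qed

end

section \<open>Transfer operators of non-singular maps\<close>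

locale nonsingular_system = prob_space M for M :: "'a::real_vector measure" +
  fixes f :: "'a \<Rightarrow> 'a"
  assumes measurable_f[measurable]: "f \<in> M \<rightarrow>\<^sub>M M"
    and nonsingular_f: "nonsingular M f"
begin

lemma measurable_iterate[measurable]: "f ^^ k \<in> M \<rightarrow>\<^sub>M M"
proof (induction k)
  case (Suc k)
  then show ?case
    using measurable_comp[OF Suc measurable_f] by simp
qed simp

lemma AE_comp:
  assumes "AE x in M. Q x"
  shows "AE x in M. Q (f x)"
proof -
  obtain N where N: "N \<in> null_sets M" "{x \<in> space M. \<not> Q x} \<subseteq> N"
    using assms by (auto elim!: AE_E3 simp: eventually_ae_filter)
  have "f -` N \<inter> space M \<in> null_sets M"
    using N(1) nonsingular_f by (auto simp: nonsingular_def)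
  moreover have "{x \<in> space M. \<not> Q (f x)} \<subseteq> f -` N \<inter> space M"
    using N(2) measurable_space[OF measurable_f] by auto
  ultimately show ?thesis
    by (rule AE_I')
qed

lemma AE_comp_iterate:
  assumes "AE x in M. Q x"
  shows "AE x in M. Q ((f ^^ k) x)"
proof (induction k)
  case (Suc k)
  show ?case
    using AE_comp[OF Suc] by (simp add: funpow_swap1)
qed (use assms in simp)

lemma AE_iterate_le_Linf_norm:
  "\<phi> \<in> Linf M \<Longrightarrow> AE x in M. \<bar>\<phi> ((f ^^ k) x)\<bar> \<le> Linf_norm M \<phi>"
  by (rule AE_comp_iterate[OF AE_le_Linf_norm])

lemma Linf_comp_iterate:
  assumes "\<phi> \<in> Linf M"
  shows "(\<lambda>x. \<phi> ((f ^^ k) x)) \<in> Linf M"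
proof (rule LinfI)
  show "(\<lambda>x. \<phi> ((f ^^ k) x)) \<in> borel_measurable M"
    using Linf_measurable[OF assms] by measurable
qed (rule AE_iterate_le_Linf_norm[OF assms])

lemma integrable_comp_iterate:
  assumes "\<phi> \<in> Linf M"
  shows "integrable M (\<lambda>x. \<phi> ((f ^^ k) x))"
  using integrable_mult_Linf[OF Linf_comp_iterate[OF assms], of "\<lambda>_. 1"] by simp

text \<open>The measure with density \<open>\<psi>\<close>, pushed forward along \<open>f\<close>, is absolutely continuous because
  \<open>f\<close> is non-singular; its Radon-Nikodym density is the required function.\<close>

lemma transfer_op_exists:
  assumes \<psi>: "integrable M \<psi>" and nonneg: "AE x in M. 0 \<le> \<psi> x"
  shows "\<exists>g. integrable M g \<and>
    (\<forall>\<phi>\<in>Linf M. (\<integral>x. \<phi> x * g x \<partial>M) = (\<integral>x. \<phi> (f x) * \<psi> x \<partial>M))"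
proof -
  have \<psi>_meas[measurable]: "\<psi> \<in> borel_measurable M"
    using \<psi> by auto
  define D where "D = density M (\<lambda>x. ennreal (\<psi> x))"
  define \<nu> where "\<nu> = distr D M f"
  have fD: "f \<in> D \<rightarrow>\<^sub>M M"
    by (simp add: D_def)
  have "absolutely_continuous M \<nu>"
    unfolding absolutely_continuous_def
  proof
    fix N assume N: "N \<in> null_sets M"
    then have "f -` N \<inter> space M \<in> null_sets M"
      using nonsingular_f by (auto simp: nonsingular_def)
    moreover have "absolutely_continuous M D"
      unfolding D_def by (rule absolutely_continuousI_density) simp
    ultimately have "f -` N \<inter> space M \<in> null_sets D"
      by (auto simp: absolutely_continuous_def)
    then show "N \<in> null_sets \<nu>"
      using N fD by (auto simp: \<nu>_def null_sets_def emeasure_distr D_def)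
  qed
  then obtain u where u[measurable]: "u \<in> borel_measurable M" and u_eq: "density M u = \<nu>"
    using Radon_Nikodym[of \<nu>] by (auto simp: \<nu>_def)
  have "(\<integral>\<^sup>+x. u x \<partial>M) = emeasure (density M u) (space M)"
    by (simp add: emeasure_density cong: nn_integral_cong)
  also have "\<dots> = emeasure D (space M)"
  proof -
    have "f -` space M \<inter> space D = space M"
      using measurable_space[OF measurable_f] by (auto simp: D_def)
    then show ?thesis
      unfolding u_eq \<nu>_def by (simp add: emeasure_distr[OF fD])
  qed
  also have "\<dots> = (\<integral>\<^sup>+x. ennreal (\<psi> x) \<partial>M)"
    unfolding D_def by (simp add: emeasure_density cong: nn_integral_cong)
  also have "\<dots> < \<infinity>"
    using integrableD(2)[OF \<psi>] nn_integral_eq_integral[OF \<psi> nonneg] by simp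
  finally have u_fin: "(\<integral>\<^sup>+x. u x \<partial>M) < \<infinity>" .
  then have u_AE: "AE x in M. u x \<noteq> \<infinity>"
    by (intro nn_integral_PInf_AE) auto
  define g where "g x = enn2real (u x)" for x
  have g[measurable]: "g \<in> borel_measurable M"
    by (simp add: g_def[abs_def])
  have g_u: "AE x in M. ennreal (g x) = u x"
    using u_AE by eventually_elim (simp add: g_def less_top)
  have g_\<nu>: "density M (\<lambda>x. ennreal (g x)) = \<nu>"
    unfolding u_eq[symmetric] using g_u by (intro density_cong) auto
  have "integrable M g"
  proof (rule integrableI_nonneg)
    show "AE x in M. 0 \<le> g x"
      by (simp add: g_def)
    show "(\<integral>\<^sup>+x. ennreal (g x) \<partial>M) < \<infinity>"
      using u_fin nn_integral_cong_AE[OF g_u] by simp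
  qed simp
  moreover have "(\<integral>x. \<phi> x * g x \<partial>M) = (\<integral>x. \<phi> (f x) * \<psi> x \<partial>M)" if "\<phi> \<in> Linf M" for \<phi>
  proof -
    have \<phi>[measurable]: "\<phi> \<in> borel_measurable M"
      using that by (rule Linf_measurable)
    have "(\<integral>x. \<phi> x * g x \<partial>M) = (\<integral>x. \<phi> x \<partial>\<nu>)"
      unfolding g_\<nu>[symmetric]
      by (subst integral_density) (auto simp: g_def mult.commute)
    also have "\<dots> = (\<integral>x. \<phi> (f x) \<partial>D)"
      unfolding \<nu>_def by (rule integral_distr[OF fD \<phi>])
    also have "\<dots> = (\<integral>x. \<phi> (f x) * \<psi> x \<partial>M)"
      unfolding D_def using nonneg by (subst integral_density) (auto simp: mult.commute)
    finally show ?thesis .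
  qed
  ultimately show ?thesis
    by blast
qed

lemma
  assumes "integrable M \<psi>" and "AE x in M. 0 \<le> \<psi> x"
  shows integrable_transfer_op: "integrable M (transfer_op M f \<psi>)"
    and transfer_op_duality: "\<phi> \<in> Linf M \<Longrightarrow>
      (\<integral>x. \<phi> x * transfer_op M f \<psi> x \<partial>M) = (\<integral>x. \<phi> (f x) * \<psi> x \<partial>M)"
  using someI_ex[OF transfer_op_exists[OF assms]] unfolding transfer_op_def by blast+

text \<open>Testing the duality relation against the indicator of the set where the transferred density
  is negative shows that this set is null.\<close>

lemma transfer_op_nonneg:
  assumes \<psi>: "integrable M \<psi>" "AE x in M. 0 \<le> \<psi> x"
  shows "AE x in M. 0 \<le> transfer_op M f \<psi> x"
proof -
  let ?g = "transfer_op M f \<psi>"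
  have int: "integrable M ?g"
    by (rule integrable_transfer_op[OF \<psi>])
  then have g[measurable]: "?g \<in> borel_measurable M"
    by auto
  define \<phi> :: "'a \<Rightarrow> real" where "\<phi> x = (if ?g x < 0 then 1 else 0)" for x
  have \<phi>_meas[measurable]: "\<phi> \<in> borel_measurable M"
    unfolding \<phi>_def[abs_def] by measurable
  have \<phi>: "\<phi> \<in> Linf M"
    by (rule LinfI[where C=1]) (auto simp: \<phi>_def)
  have "0 \<le> (\<integral>x. \<phi> (f x) * \<psi> x \<partial>M)"
    using \<psi>(2) by (intro integral_nonneg_AE) (auto simp: \<phi>_def)
  then have "(\<integral>x. - (\<phi> x * ?g x) \<partial>M) \<le> 0"
    using transfer_op_duality[OF \<psi> \<phi>] by simp
  moreover have int': "integrable M (\<lambda>x. - (\<phi> x * ?g x))"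
    using integrable_mult_Linf[OF \<phi> int] by simp
  moreover have pos: "0 \<le> - (\<phi> x * ?g x)" for x
    by (simp add: \<phi>_def)
  ultimately have "(\<integral>x. - (\<phi> x * ?g x) \<partial>M) = 0"
    by (intro antisym integral_nonneg_AE) auto
  then have "AE x in M. - (\<phi> x * ?g x) = 0"
    using integral_nonneg_eq_0_iff_AE[OF int'] pos by blast
  then show ?thesis
    by eventually_elim (auto simp: \<phi>_def split: if_splits)
qed

lemma
  shows integrable_transfer_power: "integrable M ((transfer_op M f ^^ k) (\<lambda>_. 1))"
    and transfer_power_nonneg: "AE x in M. 0 \<le> (transfer_op M f ^^ k) (\<lambda>_. 1) x"
proof (induction k)
  case (Suc k)
  { case 1 show ?case using Suc by (simp add: integrable_transfer_op) }
  { case 2 show ?case using Suc by (simp add: transfer_op_nonneg) }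
qed auto

lemma transfer_power_duality:
  assumes "\<phi> \<in> Linf M"
  shows "(\<integral>x. \<phi> x * (transfer_op M f ^^ k) (\<lambda>_. 1) x \<partial>M) = (\<integral>x. \<phi> ((f ^^ k) x) \<partial>M)"
  using assms
proof (induction k arbitrary: \<phi>)
  case (Suc k)
  have "(\<lambda>x. \<phi> (f x)) \<in> Linf M"
    using Linf_comp_iterate[OF Suc.prems, of 1] by simp
  then show ?case
    using transfer_op_duality[OF integrable_transfer_power transfer_power_nonneg Suc.prems]
      Suc.IH[of "\<lambda>x. \<phi> (f x)"] by simp
qed simp

end

section \<open>The stationary density\<close>

locale perturbed_system = nonsingular_system +
  fixes \<epsilon> :: real
  assumes \<epsilon>_pos: "0 < \<epsilon>" and \<epsilon>_less_1: "\<epsilon> < 1"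
begin

abbreviation "h \<equiv> stationary_density \<epsilon> M f"

abbreviation "push k \<equiv> (transfer_op M f ^^ k) (\<lambda>_. 1)"

lemma measurable_push[measurable]: "push k \<in> borel_measurable M"
  using integrable_transfer_power[of k] by auto

lemma measurable_stationary_density[measurable]: "h \<in> borel_measurable M"
  unfolding stationary_density_def[abs_def] by measurable

lemma push_L1: "(\<integral>x. push k x \<partial>M) = 1"
  using transfer_power_duality[OF LinfI[of "\<lambda>_. 1" 1], of k] by (simp add: prob_space)

text \<open>Each iterated transfer of the constant density has mass one, so the series with
  geometric weights has finite integral and therefore converges almost everywhere.\<close>

lemma AE_summable_push: "AE x in M. summable (\<lambda>k. (1 - \<epsilon>) ^ k * push k x)"
proof -
  have nn: "AE x in M. \<forall>k. 0 \<le> push k x"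
    unfolding AE_all_countable using transfer_power_nonneg by blast
  have k: "(\<integral>\<^sup>+x. ennreal ((1 - \<epsilon>) ^ k * push k x) \<partial>M) = ennreal ((1 - \<epsilon>) ^ k)" for k
  proof -
    have "(\<integral>\<^sup>+x. ennreal ((1 - \<epsilon>) ^ k * push k x) \<partial>M)
        = ennreal (\<integral>x. (1 - \<epsilon>) ^ k * push k x \<partial>M)"
      using nn \<epsilon>_less_1 integrable_transfer_power[of k]
      by (intro nn_integral_eq_integral) auto
    then show ?thesis
      by (simp add: push_L1)
  qed
  have "(\<integral>\<^sup>+x. (\<Sum>k. ennreal ((1 - \<epsilon>) ^ k * push k x)) \<partial>M) = (\<Sum>k. ennreal ((1 - \<epsilon>) ^ k))"
    by (subst nn_integral_suminf) (auto simp: k)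
  also have "\<dots> = ennreal (\<Sum>k. (1 - \<epsilon>) ^ k)"
    using \<epsilon>_pos \<epsilon>_less_1 by (intro suminf_ennreal2 summable_geometric) auto
  finally have "AE x in M. (\<Sum>k. ennreal ((1 - \<epsilon>) ^ k * push k x)) \<noteq> \<infinity>"
    by (intro nn_integral_PInf_AE) auto
  with nn show ?thesis
    by eventually_elim (use \<epsilon>_less_1 in \<open>auto intro!: summable_suminf_not_top\<close>)
qed

lemma stationary_density_nonneg: "AE x in M. 0 \<le> h x"
proof -
  have "AE x in M. \<forall>k. 0 \<le> push k x"
    unfolding AE_all_countable using transfer_power_nonneg by blast
  with AE_summable_push show ?thesis
    by eventually_elim
      (use \<epsilon>_pos \<epsilon>_less_1 in \<open>auto simp: stationary_density_def intro!: suminf_nonneg mult_nonneg_nonneg\<close>)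
qed

lemma
  assumes \<phi>: "\<phi> \<in> Linf M"
  shows integrable_mult_stationary_density: "integrable M (\<lambda>x. \<phi> x * h x)"
    and sums_integral_stationary_density:
      "(\<lambda>k. \<epsilon> * (1 - \<epsilon>) ^ k * (\<integral>x. \<phi> ((f ^^ k) x) \<partial>M)) sums (\<integral>x. \<phi> x * h x \<partial>M)"
proof -
  define t where "t k x = \<epsilon> * (1 - \<epsilon>) ^ k * (\<phi> x * push k x)" for k x
  have t_int: "integrable M (t k)" for k
    unfolding t_def[abs_def] using integrable_mult_Linf[OF \<phi> integrable_transfer_power] by simp
  have nn: "AE x in M. \<forall>k. 0 \<le> push k x"
    unfolding AE_all_countable using transfer_power_nonneg by blast
  from nn AE_summable_push have t_summable: "AE x in M. summable (\<lambda>k. norm (t k x))"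
  proof eventually_elim
    case (elim x)
    then have "(\<lambda>k. norm (t k x)) = (\<lambda>k. \<epsilon> * \<bar>\<phi> x\<bar> * ((1 - \<epsilon>) ^ k * push k x))"
      using \<epsilon>_pos \<epsilon>_less_1 by (auto simp: t_def abs_mult)
    with elim show ?case
      by (simp add: summable_mult)
  qed
  have t_bound: "(\<integral>x. norm (t k x) \<partial>M) \<le> \<epsilon> * Linf_norm M \<phi> * (1 - \<epsilon>) ^ k" for k
  proof -
    have "(\<integral>x. norm (t k x) \<partial>M) \<le> (\<integral>x. \<epsilon> * Linf_norm M \<phi> * (1 - \<epsilon>) ^ k * push k x \<partial>M)"
    proof (rule integral_mono_AE)
      show "AE x in M. norm (t k x) \<le> \<epsilon> * Linf_norm M \<phi> * (1 - \<epsilon>) ^ k * push k x"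
        using nn AE_le_Linf_norm[OF \<phi>]
      proof eventually_elim
        case (elim x)
        have "norm (t k x) = \<epsilon> * (1 - \<epsilon>) ^ k * push k x * \<bar>\<phi> x\<bar>"
          using \<epsilon>_pos \<epsilon>_less_1 elim by (simp add: t_def abs_mult)
        also have "\<dots> \<le> \<epsilon> * (1 - \<epsilon>) ^ k * push k x * Linf_norm M \<phi>"
          using \<epsilon>_pos \<epsilon>_less_1 elim by (intro mult_left_mono) auto
        finally show ?case
          by (simp add: ac_simps)
      qed
    qed (use t_int integrable_transfer_power in auto)
    then show ?thesis
      by (simp add: push_L1)
  qed
  have t_summable': "summable (\<lambda>k. \<integral>x. norm (t k x) \<partial>M)"
  proof (rule summable_comparison_test)
    show "summable (\<lambda>k. \<epsilon> * Linf_norm M \<phi> * (1 - \<epsilon>) ^ k)"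
      using \<epsilon>_pos \<epsilon>_less_1 by (intro summable_mult summable_geometric) auto
    show "\<exists>N. \<forall>k\<ge>N. norm (\<integral>x. norm (t k x) \<partial>M) \<le> \<epsilon> * Linf_norm M \<phi> * (1 - \<epsilon>) ^ k"
      using t_bound by auto
  qed
  have t_suminf: "AE x in M. (\<Sum>k. t k x) = \<phi> x * h x"
    using AE_summable_push
  proof eventually_elim
    case (elim x)
    have "(\<Sum>k. t k x) = (\<Sum>k. \<epsilon> * \<phi> x * ((1 - \<epsilon>) ^ k * push k x))"
      by (simp add: t_def ac_simps)
    also have "\<dots> = \<epsilon> * \<phi> x * (\<Sum>k. (1 - \<epsilon>) ^ k * push k x)"
      by (rule suminf_mult[OF elim])
    finally show ?case
      by (simp add: stationary_density_def)
  qed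
  have meas: "(\<lambda>x. \<phi> x * h x) \<in> borel_measurable M"
    using Linf_measurable[OF \<phi>] by measurable
  have t_meas: "(\<lambda>x. \<Sum>k. t k x) \<in> borel_measurable M"
    using t_int by (auto intro!: borel_measurable_suminf)
  show "integrable M (\<lambda>x. \<phi> x * h x)"
    using integrable_suminf[OF t_int t_summable t_summable']
      integrable_cong_AE[OF t_meas meas t_suminf] by simp
  have "(\<lambda>k. integral\<^sup>L M (t k)) sums (\<integral>x. (\<Sum>k. t k x) \<partial>M)"
    by (rule sums_integral[OF t_int t_summable t_summable'])
  moreover have "(\<integral>x. (\<Sum>k. t k x) \<partial>M) = (\<integral>x. \<phi> x * h x \<partial>M)"
    by (rule integral_cong_AE[OF t_meas meas t_suminf])
  moreover have "integral\<^sup>L M (t k) = \<epsilon> * (1 - \<epsilon>) ^ k * (\<integral>x. \<phi> ((f ^^ k) x) \<partial>M)" for k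
    by (simp add: t_def[abs_def] transfer_power_duality[OF \<phi>])
  ultimately show "(\<lambda>k. \<epsilon> * (1 - \<epsilon>) ^ k * (\<integral>x. \<phi> ((f ^^ k) x) \<partial>M))
      sums (\<integral>x. \<phi> x * h x \<partial>M)"
    by simp
qed

lemma integrable_stationary_density: "integrable M h"
  using integrable_mult_stationary_density[OF LinfI[of "\<lambda>_. 1" 1]] by simp

lemma integral_stationary_measure:
  assumes "\<phi> \<in> borel_measurable M"
  shows "(\<integral>x. \<phi> x \<partial>stationary_measure \<epsilon> M f) = (\<integral>x. \<phi> x * h x \<partial>M)"
  unfolding stationary_measure_def
  by (subst integral_density[OF assms measurable_stationary_density stationary_density_nonneg])
    (simp add: mult.commute)

section \<open>Averaging over the noise\<close>

lemma measurable_perturbed[measurable]: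
  "(\<lambda>(s, x). perturbed f s x) \<in> noise \<epsilon> M \<Otimes>\<^sub>M M \<rightarrow>\<^sub>M M"
proof -
  have "(\<lambda>(s, x). if fst s then f x else snd s)
      \<in> (count_space UNIV \<Otimes>\<^sub>M M) \<Otimes>\<^sub>M M \<rightarrow>\<^sub>M M"
    by measurable
  moreover have "perturbed f s x = (if fst s then f x else snd s)" for s x
    by (cases s) auto
  moreover have "sets (noise \<epsilon> M \<Otimes>\<^sub>M M) = sets ((count_space UNIV \<Otimes>\<^sub>M M) \<Otimes>\<^sub>M M)"
    unfolding noise_def by (intro sets_pair_measure_cong) simp_all
  ultimately show ?thesis
    by (simp cong: measurable_cong_sets)
qed

lemma nn_integral_noise:
  assumes v[measurable]: "v \<in> borel_measurable M" and x: "x \<in> space M"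
  shows "(\<integral>\<^sup>+s. v (perturbed f s x) \<partial>noise \<epsilon> M)
    = ennreal (1 - \<epsilon>) * v (f x) + ennreal \<epsilon> * (\<integral>\<^sup>+y. v y \<partial>M)"
proof -
  have "(\<lambda>s. v (perturbed f s x)) \<in> borel_measurable (noise \<epsilon> M)"
    using x by measurable
  then have "(\<integral>\<^sup>+s. v (perturbed f s x) \<partial>noise \<epsilon> M)
      = (\<integral>\<^sup>+b. \<integral>\<^sup>+y. v (perturbed f (b, y) x) \<partial>M \<partial>measure_pmf (bernoulli_pmf (1 - \<epsilon>)))"
    unfolding noise_def by (subst nn_integral_fst) auto
  then show ?thesis
    using \<epsilon>_pos \<epsilon>_less_1 by (simp add: emeasure_space_1 mult.commute)
qed

lemma prob_space_noise: "prob_space (noise \<epsilon> M)"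
proof -
  interpret pair_prob_space "measure_pmf (bernoulli_pmf (1 - \<epsilon>))" M ..
  show ?thesis
    unfolding noise_def by (rule prob_space_axioms)
qed

sublocale noise: sequence_space "noise \<epsilon> M"
proof -
  interpret N: prob_space "noise \<epsilon> M"
    by (rule prob_space_noise)
  show "sequence_space (noise \<epsilon> M)" ..
qed

lemma prob_space_noise_seq: "prob_space (noise_seq \<epsilon> M)"
  unfolding noise_seq_def by (rule noise.P.prob_space_axioms)

lemma measurable_random_iterate[measurable]:
  "(\<lambda>(\<omega>, x). random_iterate f n \<omega> x) \<in> noise_seq \<epsilon> M \<Otimes>\<^sub>M M \<rightarrow>\<^sub>M M"
proof (induction n)
  case (Suc n)
  note [measurable] = Suc
  have [measurable]: "(\<lambda>\<omega>. \<omega> n) \<in> noise_seq \<epsilon> M \<rightarrow>\<^sub>M noise \<epsilon> M"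
    unfolding noise_seq_def by measurable
  have "(\<lambda>p. (fst p n, random_iterate f n (fst p) (snd p)))
      \<in> noise_seq \<epsilon> M \<Otimes>\<^sub>M M \<rightarrow>\<^sub>M noise \<epsilon> M \<Otimes>\<^sub>M M"
    by measurable
  from measurable_compose[OF this measurable_perturbed] show ?case
    by (simp add: case_prod_beta')
qed (simp add: case_prod_beta')

lemma random_iterate_case_nat:
  "random_iterate f (Suc n) (case_nat s \<omega>) x = random_iterate f n \<omega> (perturbed f s x)"
  by (induction n) auto

text \<open>The weight \<open>(1 - \<epsilon>) ^ n\<close> is the probability that no restart occurs during \<open>n\<close> steps, and
  \<open>\<epsilon> * (1 - \<epsilon>) ^ k\<close> is the probability that the last restart is followed by exactly \<open>k\<close>
  applications of \<open>f\<close>. The proof conditions on the first step, since the remaining noise is again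
  an independent sequence with the same law. Working with extended non-negative integrals makes the
  formula valid at every \<open>x\<close>, also where \<open>g\<close> exceeds its essential supremum, so no exceptional set
  has to be followed through the random iterates.\<close>

lemma nn_integral_random_iterate:
  fixes g :: "'a \<Rightarrow> ennreal"
  assumes g[measurable]: "g \<in> borel_measurable M" and x: "x \<in> space M"
  shows "(\<integral>\<^sup>+\<omega>. g (random_iterate f n \<omega> x) \<partial>noise_seq \<epsilon> M)
    = ennreal ((1 - \<epsilon>) ^ n) * g ((f ^^ n) x)
      + (\<Sum>k<n. ennreal (\<epsilon> * (1 - \<epsilon>) ^ k) * (\<integral>\<^sup>+y. g ((f ^^ k) y) \<partial>M))"
  using x
proof (induction n arbitrary: x)
  case 0
  interpret S: prob_space "noise_seq \<epsilon> M"
    by (rule prob_space_noise_seq)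
  show ?case
    by (simp add: S.emeasure_space_1)
next
  case (Suc n)
  note x[simp] = \<open>x \<in> space M\<close>
  define I where "I k = (\<integral>\<^sup>+y. g ((f ^^ k) y) \<partial>M)" for k
  define C where "C = (\<Sum>k<n. ennreal (\<epsilon> * (1 - \<epsilon>) ^ k) * I k)"
  define v where "v y = ennreal ((1 - \<epsilon>) ^ n) * g ((f ^^ n) y) + C" for y
  have v[measurable]: "v \<in> borel_measurable M"
    unfolding v_def[abs_def] by measurable
  interpret S: prob_space "noise_seq \<epsilon> M"
    by (rule prob_space_noise_seq)
  \<comment> \<open>An independent first entry prepended to a noise sequence gives a noise sequence again.\<close>
  have iter: "noise_seq \<epsilon> M
      = distr (noise \<epsilon> M \<Otimes>\<^sub>M noise_seq \<epsilon> M) (noise_seq \<epsilon> M) (\<lambda>(s, \<omega>). case_nat s \<omega>)"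
    unfolding noise_seq_def by (rule noise.PiM_iter[symmetric])
  have cons: "(\<lambda>(s, \<omega>). case_nat s \<omega>) \<in> noise \<epsilon> M \<Otimes>\<^sub>M noise_seq \<epsilon> M \<rightarrow>\<^sub>M noise_seq \<epsilon> M"
    unfolding noise_seq_def by measurable
  have F: "(\<lambda>\<omega>. g (random_iterate f (Suc n) \<omega> x)) \<in> borel_measurable (noise_seq \<epsilon> M)"
    by measurable
  have space: "perturbed f s x \<in> space M" if "s \<in> space (noise \<epsilon> M)" for s
    using that measurable_space[OF measurable_perturbed, of "(s, x)"]
    by (auto simp: space_pair_measure)
  have G: "(\<lambda>p. g (random_iterate f (Suc n) (case p of (s, \<omega>) \<Rightarrow> case_nat s \<omega>) x))
      \<in> borel_measurable (noise \<epsilon> M \<Otimes>\<^sub>M noise_seq \<epsilon> M)"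
    by (rule measurable_compose[OF cons F])
  have "(\<integral>\<^sup>+\<omega>. g (random_iterate f (Suc n) \<omega> x) \<partial>noise_seq \<epsilon> M)
      = (\<integral>\<^sup>+p. g (random_iterate f (Suc n) (case p of (s, \<omega>) \<Rightarrow> case_nat s \<omega>) x)
          \<partial>(noise \<epsilon> M \<Otimes>\<^sub>M noise_seq \<epsilon> M))"
    by (subst iter, rule nn_integral_distr[OF cons]) (use F in simp)
  also have "\<dots> = (\<integral>\<^sup>+s. \<integral>\<^sup>+\<omega>. g (random_iterate f n \<omega> (perturbed f s x))
      \<partial>noise_seq \<epsilon> M \<partial>noise \<epsilon> M)"
    unfolding S.nn_integral_fst[OF G, symmetric]
    by (simp add: random_iterate_case_nat del: random_iterate.simps)
  also have "\<dots> = (\<integral>\<^sup>+s. v (perturbed f s x) \<partial>noise \<epsilon> M)"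
    using Suc.IH space by (intro nn_integral_cong) (auto simp: v_def C_def I_def)
  also have "\<dots> = ennreal (1 - \<epsilon>) * v (f x) + ennreal \<epsilon> * (\<integral>\<^sup>+y. v y \<partial>M)"
    by (rule nn_integral_noise[OF v x])
  also have "(\<integral>\<^sup>+y. v y \<partial>M) = ennreal ((1 - \<epsilon>) ^ n) * I n + C"
    unfolding v_def I_def by (simp add: nn_integral_add nn_integral_cmult emeasure_space_1)
  also have "ennreal (1 - \<epsilon>) * v (f x) + ennreal \<epsilon> * (ennreal ((1 - \<epsilon>) ^ n) * I n + C)
      = ennreal ((1 - \<epsilon>) ^ Suc n) * g ((f ^^ Suc n) x)
        + (ennreal (1 - \<epsilon>) + ennreal \<epsilon>) * C + ennreal (\<epsilon> * (1 - \<epsilon>) ^ n) * I n"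
  proof -
    have "ennreal ((1 - \<epsilon>) ^ Suc n) = ennreal (1 - \<epsilon>) * ennreal ((1 - \<epsilon>) ^ n)"
      and "ennreal (\<epsilon> * (1 - \<epsilon>) ^ n) = ennreal \<epsilon> * ennreal ((1 - \<epsilon>) ^ n)"
      using \<epsilon>_pos \<epsilon>_less_1 by (simp_all add: ennreal_mult)
    moreover have "(f ^^ Suc n) x = (f ^^ n) (f x)"
      by (simp add: funpow_swap1)
    ultimately show ?thesis
      by (simp only: v_def distrib_left distrib_right ac_simps)
  qed
  also have "ennreal (1 - \<epsilon>) + ennreal \<epsilon> = 1"
    using \<epsilon>_pos \<epsilon>_less_1 by (simp flip: ennreal_plus)
  finally show ?case
    by (simp add: C_def I_def add.assoc)
qed

text \<open>The extended non-negative formula applies to the positive and the negative part of \<open>\<phi>\<close>, and all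
  its terms are finite because \<open>\<phi> \<circ> f ^^ k\<close> is essentially bounded for every \<open>k\<close>.\<close>

lemma
  assumes \<phi>: "\<phi> \<in> Linf M" and x: "x \<in> space M"
  shows integrable_random_iterate:
      "integrable (noise_seq \<epsilon> M) (\<lambda>\<omega>. \<phi> (random_iterate f n \<omega> x))"
    and integral_random_iterate: "(\<integral>\<omega>. \<phi> (random_iterate f n \<omega> x) \<partial>noise_seq \<epsilon> M)
      = (1 - \<epsilon>) ^ n * \<phi> ((f ^^ n) x) + (\<Sum>k<n. \<epsilon> * (1 - \<epsilon>) ^ k * (\<integral>y. \<phi> ((f ^^ k) y) \<partial>M))"
proof -
  note [measurable] = Linf_measurable[OF \<phi>]
  note x[simp]
  define p where "p y = max 0 (\<phi> y)" for y
  define q where "q y = max 0 (- \<phi> y)" for y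
  have p: "p \<in> Linf M"
    by (rule LinfI[where C="Linf_norm M \<phi>"])
      (use AE_le_Linf_norm[OF \<phi>] Linf_norm_nonneg[OF \<phi>] in \<open>auto simp: p_def[abs_def]\<close>)
  have q: "q \<in> Linf M"
    by (rule LinfI[where C="Linf_norm M \<phi>"])
      (use AE_le_Linf_norm[OF \<phi>] Linf_norm_nonneg[OF \<phi>] in \<open>auto simp: q_def[abs_def]\<close>)
  have \<phi>_pq: "\<phi> y = p y - q y" for y
    by (simp add: p_def q_def)
  have int: "integrable (noise_seq \<epsilon> M) (\<lambda>\<omega>. u (random_iterate f n \<omega> x))"
      "(\<integral>\<omega>. u (random_iterate f n \<omega> x) \<partial>noise_seq \<epsilon> M)
      = (1 - \<epsilon>) ^ n * u ((f ^^ n) x) + (\<Sum>k<n. \<epsilon> * (1 - \<epsilon>) ^ k * (\<integral>y. u ((f ^^ k) y) \<partial>M))"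
    if u: "u \<in> Linf M" and nonneg: "\<And>y. 0 \<le> u y" for u :: "'a \<Rightarrow> real"
  proof -
    let ?r = "(1 - \<epsilon>) ^ n * u ((f ^^ n) x)
        + (\<Sum>k<n. \<epsilon> * (1 - \<epsilon>) ^ k * (\<integral>y. u ((f ^^ k) y) \<partial>M))"
    have [measurable]: "u \<in> borel_measurable M"
      by (rule Linf_measurable[OF u])
    have m: "(\<lambda>\<omega>. u (random_iterate f n \<omega> x)) \<in> borel_measurable (noise_seq \<epsilon> M)"
      by measurable
    have k: "(\<integral>\<^sup>+y. ennreal (u ((f ^^ k) y)) \<partial>M) = ennreal (\<integral>y. u ((f ^^ k) y) \<partial>M)" for k
      using integrable_comp_iterate[OF u] nonneg by (intro nn_integral_eq_integral) auto
    have pos: "0 \<le> \<epsilon> * (1 - \<epsilon>) ^ k * (\<integral>y. u ((f ^^ k) y) \<partial>M)" for k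
      using \<epsilon>_pos \<epsilon>_less_1 nonneg by simp
    have pos': "0 \<le> (1 - \<epsilon>) ^ n * u ((f ^^ n) x)"
      using \<epsilon>_less_1 nonneg by simp
    have "(\<integral>\<^sup>+\<omega>. ennreal (u (random_iterate f n \<omega> x)) \<partial>noise_seq \<epsilon> M)
        = ennreal ((1 - \<epsilon>) ^ n * u ((f ^^ n) x))
          + (\<Sum>k<n. ennreal (\<epsilon> * (1 - \<epsilon>) ^ k * (\<integral>y. u ((f ^^ k) y) \<partial>M)))"
      using \<epsilon>_pos \<epsilon>_less_1 nonneg
      by (subst nn_integral_random_iterate) (auto simp: k ennreal_mult)
    also have "\<dots> = ennreal ?r"
      using pos pos' by (simp add: sum_nonneg ennreal_plus)
    finally have "(\<integral>\<^sup>+\<omega>. ennreal (u (random_iterate f n \<omega> x)) \<partial>noise_seq \<epsilon> M) = ennreal ?r" .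
    moreover have "0 \<le> ?r"
      using pos pos' by (simp add: sum_nonneg)
    ultimately have "integrable (noise_seq \<epsilon> M) (\<lambda>\<omega>. u (random_iterate f n \<omega> x))
        \<and> (\<integral>\<omega>. u (random_iterate f n \<omega> x) \<partial>noise_seq \<epsilon> M) = ?r"
      using nn_integral_eq_integrable[OF m] nonneg by simp
    then show "integrable (noise_seq \<epsilon> M) (\<lambda>\<omega>. u (random_iterate f n \<omega> x))"
      "(\<integral>\<omega>. u (random_iterate f n \<omega> x) \<partial>noise_seq \<epsilon> M) = ?r"
      by auto
  qed
  have nonneg: "0 \<le> p y" "0 \<le> q y" for y
    by (simp_all add: p_def q_def)
  show "integrable (noise_seq \<epsilon> M) (\<lambda>\<omega>. \<phi> (random_iterate f n \<omega> x))"
    unfolding \<phi>_pq using int(1)[OF p nonneg(1)] int(1)[OF q nonneg(2)] by simp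
  show "(\<integral>\<omega>. \<phi> (random_iterate f n \<omega> x) \<partial>noise_seq \<epsilon> M)
      = (1 - \<epsilon>) ^ n * \<phi> ((f ^^ n) x) + (\<Sum>k<n. \<epsilon> * (1 - \<epsilon>) ^ k * (\<integral>y. \<phi> ((f ^^ k) y) \<partial>M))"
    unfolding \<phi>_pq using int[OF p nonneg(1)] int[OF q nonneg(2)]
      integrable_comp_iterate[OF p] integrable_comp_iterate[OF q]
    by (simp add: right_diff_distrib sum_subtractf)
qed

section \<open>Decay of correlations\<close>

text \<open>Fubini's theorem moves the average over the noise inside, where it is known pointwise. The
  joint integrability it needs comes from the same pointwise formula applied to \<open>\<bar>\<phi>\<bar>\<close>.\<close>

lemma integral_random_iterate_mult:
  assumes \<phi>: "\<phi> \<in> Linf M" and g: "integrable M g"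
  shows "(\<integral>\<omega>. \<integral>x. \<phi> (random_iterate f n \<omega> x) * g x \<partial>M \<partial>noise_seq \<epsilon> M)
    = (1 - \<epsilon>) ^ n * (\<integral>x. \<phi> ((f ^^ n) x) * g x \<partial>M)
      + (\<Sum>k<n. \<epsilon> * (1 - \<epsilon>) ^ k * (\<integral>y. \<phi> ((f ^^ k) y) \<partial>M)) * (\<integral>x. g x \<partial>M)"
proof -
  interpret S: prob_space "noise_seq \<epsilon> M"
    by (rule prob_space_noise_seq)
  interpret MS: pair_sigma_finite M "noise_seq \<epsilon> M" ..
  have \<phi>_meas[measurable]: "\<phi> \<in> borel_measurable M"
    by (rule Linf_measurable[OF \<phi>])
  have g_meas[measurable]: "g \<in> borel_measurable M"
    using g by auto
  define K where "K u x = (1 - \<epsilon>) ^ n * u ((f ^^ n) x)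
    + (\<Sum>k<n. \<epsilon> * (1 - \<epsilon>) ^ k * (\<integral>y. u ((f ^^ k) y) \<partial>M))" for u :: "'a \<Rightarrow> real" and x
  have K_mult: "integrable M (\<lambda>x. K u x * g x)" if "u \<in> Linf M" for u
    using g integrable_mult_Linf[OF Linf_comp_iterate[OF that] g]
    by (simp add: K_def distrib_right mult.assoc)
  have abs: "(\<lambda>x. \<bar>\<phi> x\<bar>) \<in> Linf M"
    using AE_le_Linf_norm[OF \<phi>] by (intro LinfI[where C="Linf_norm M \<phi>"]) auto
  have "integrable (M \<Otimes>\<^sub>M noise_seq \<epsilon> M) (\<lambda>(x, \<omega>). \<phi> (random_iterate f n \<omega> x) * g x)"
  proof (rule MS.Fubini_integrable)
    show "(\<lambda>(x, \<omega>). \<phi> (random_iterate f n \<omega> x) * g x)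
        \<in> borel_measurable (M \<Otimes>\<^sub>M noise_seq \<epsilon> M)"
      by measurable
    have "integrable M (\<lambda>x. \<bar>K (\<lambda>x. \<bar>\<phi> x\<bar>) x * g x\<bar>)"
      by (rule integrable_abs[OF K_mult[OF abs]])
    moreover have "\<bar>K (\<lambda>x. \<bar>\<phi> x\<bar>) x * g x\<bar> = (\<integral>\<omega>. norm (\<phi> (random_iterate f n \<omega> x) * g x) \<partial>noise_seq \<epsilon> M)"
      if "x \<in> space M" for x
    proof -
      have "0 \<le> K (\<lambda>x. \<bar>\<phi> x\<bar>) x"
        unfolding K_def using \<epsilon>_pos \<epsilon>_less_1
        by (intro add_nonneg_nonneg sum_nonneg mult_nonneg_nonneg integral_nonneg_AE) auto
      then show ?thesis
        using integral_random_iterate[OF abs that, of n] by (simp add: K_def abs_mult)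
    qed
    ultimately show "integrable M (\<lambda>x. \<integral>\<omega>. norm (case (x, \<omega>) of (x, \<omega>) \<Rightarrow>
        \<phi> (random_iterate f n \<omega> x) * g x) \<partial>noise_seq \<epsilon> M)"
      by (simp cong: Bochner_Integration.integrable_cong)
    show "AE x in M. integrable (noise_seq \<epsilon> M)
        (\<lambda>\<omega>. case (x, \<omega>) of (x, \<omega>) \<Rightarrow> \<phi> (random_iterate f n \<omega> x) * g x)"
      using integrable_random_iterate[OF \<phi>] by (intro AE_I2) simp
  qed
  then have "(\<integral>\<omega>. \<integral>x. \<phi> (random_iterate f n \<omega> x) * g x \<partial>M \<partial>noise_seq \<epsilon> M)
      = (\<integral>x. \<integral>\<omega>. \<phi> (random_iterate f n \<omega> x) * g x \<partial>noise_seq \<epsilon> M \<partial>M)"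
    by (rule MS.Fubini_integral)
  also have "\<dots> = (\<integral>x. K \<phi> x * g x \<partial>M)"
    by (intro Bochner_Integration.integral_cong) (simp_all add: integral_random_iterate[OF \<phi>] K_def)
  also have "\<dots> = (1 - \<epsilon>) ^ n * (\<integral>x. \<phi> ((f ^^ n) x) * g x \<partial>M)
      + (\<Sum>k<n. \<epsilon> * (1 - \<epsilon>) ^ k * (\<integral>y. \<phi> ((f ^^ k) y) \<partial>M)) * (\<integral>x. g x \<partial>M)"
    using g integrable_mult_Linf[OF Linf_comp_iterate[OF \<phi>] g]
    by (simp add: K_def distrib_right mult.assoc)
  finally show ?thesis .
qed

text \<open>The integral of \<open>\<phi>\<close> against the stationary density is a series with geometric weights,
  whose tail after \<open>n\<close> terms is the same series for \<open>\<phi> \<circ> f ^^ n\<close>, scaled by \<open>(1 - \<epsilon>) ^ n\<close>.\<close>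

lemma integral_stationary_density_split:
  assumes \<phi>: "\<phi> \<in> Linf M"
  shows "(\<integral>x. \<phi> x * h x \<partial>M)
    = (\<Sum>k<n. \<epsilon> * (1 - \<epsilon>) ^ k * (\<integral>y. \<phi> ((f ^^ k) y) \<partial>M))
      + (1 - \<epsilon>) ^ n * (\<integral>x. \<phi> ((f ^^ n) x) * h x \<partial>M)"
proof -
  let ?t = "\<lambda>k. \<epsilon> * (1 - \<epsilon>) ^ k * (\<integral>y. \<phi> ((f ^^ k) y) \<partial>M)"
  have "(\<lambda>k. (1 - \<epsilon>) ^ n * (\<epsilon> * (1 - \<epsilon>) ^ k * (\<integral>x. \<phi> ((f ^^ n) ((f ^^ k) x)) \<partial>M)))
      sums ((1 - \<epsilon>) ^ n * (\<integral>x. \<phi> ((f ^^ n) x) * h x \<partial>M))"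
    by (rule sums_mult[OF sums_integral_stationary_density[OF Linf_comp_iterate[OF \<phi>]]])
  moreover have "(f ^^ (k + n)) x = (f ^^ n) ((f ^^ k) x)" for k x
    by (metis add.commute comp_apply funpow_add)
  ultimately have "(\<lambda>k. ?t (k + n)) sums ((1 - \<epsilon>) ^ n * (\<integral>x. \<phi> ((f ^^ n) x) * h x \<partial>M))"
    by (simp add: power_add mult.assoc mult.left_commute)
  then have "?t sums ((1 - \<epsilon>) ^ n * (\<integral>x. \<phi> ((f ^^ n) x) * h x \<partial>M) + (\<Sum>k<n. ?t k))"
    by (rule sums_iff_shift[where f="?t", THEN iffD1])
  then show ?thesis
    using sums_unique2[OF sums_integral_stationary_density[OF \<phi>]] by (simp add: add.commute)
qed

lemma L1_norm_stationary_density: "L1_norm M h = 1"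
proof -
  have "(\<lambda>k. \<epsilon> * (1 - \<epsilon>) ^ k) sums (\<integral>x. h x \<partial>M)"
    using sums_integral_stationary_density[OF LinfI[of "\<lambda>_. 1" 1]] by (simp add: prob_space)
  moreover have "(\<lambda>k. \<epsilon> * (1 - \<epsilon>) ^ k) sums (\<epsilon> * (1 / (1 - (1 - \<epsilon>))))"
    using \<epsilon>_pos \<epsilon>_less_1 by (intro sums_mult geometric_sums) auto
  ultimately have "(\<integral>x. h x \<partial>M) = 1"
    using \<epsilon>_pos sums_unique2 by fastforce
  moreover have "(\<integral>x. \<bar>h x\<bar> \<partial>M) = (\<integral>x. h x \<partial>M)"
    using stationary_density_nonneg by (intro integral_cong_AE) auto
  ultimately show ?thesis
    by (simp add: L1_norm_def)
qed

text \<open>After a restart the position no longer depends on the initial point, so only noise sequences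
  without a restart contribute to the correlation; they have probability \<open>(1 - \<epsilon>) ^ n\<close>.\<close>

lemma random_correlation_eq:
  assumes \<phi>: "\<phi> \<in> Linf M" and g: "integrable M g"
  shows "(\<integral>\<omega>. \<integral>x. \<phi> (random_iterate f n \<omega> x) * g x \<partial>M \<partial>noise_seq \<epsilon> M)
      - (\<integral>x. \<phi> x * h x \<partial>M) * (\<integral>x. g x \<partial>M)
    = (1 - \<epsilon>) ^ n * ((\<integral>x. \<phi> ((f ^^ n) x) * g x \<partial>M)
      - (\<integral>x. \<phi> ((f ^^ n) x) * h x \<partial>M) * (\<integral>x. g x \<partial>M))"
  unfolding integral_random_iterate_mult[OF assms] integral_stationary_density_split[OF \<phi>, of n]
  by (simp add: algebra_simps)

theorem random_correlation_bound:
  assumes \<phi>: "\<phi> \<in> Linf M" and \<psi>: "\<psi> \<in> Linf M"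
  shows "\<bar>(\<integral>\<omega>. (\<integral>x. \<phi> (random_iterate f n \<omega> x) * \<psi> x \<partial>stationary_measure \<epsilon> M f)
        \<partial>noise_seq \<epsilon> M)
      - (\<integral>x. \<phi> x \<partial>stationary_measure \<epsilon> M f) * (\<integral>x. \<psi> x \<partial>stationary_measure \<epsilon> M f)\<bar>
    \<le> 2 * (1 - \<epsilon>) ^ n * Linf_norm M \<phi> * L1_norm M (\<lambda>x. \<psi> x * h x)"
proof -
  let ?g = "\<lambda>x. \<psi> x * h x" and ?c = "Linf_norm M \<phi>" and ?\<phi>n = "\<lambda>x. \<phi> ((f ^^ n) x)"
  have [measurable]: "\<phi> \<in> borel_measurable M" "\<psi> \<in> borel_measurable M"
    using \<phi> \<psi> by (auto intro: Linf_measurable)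
  have g: "integrable M ?g"
    by (rule integrable_mult_stationary_density[OF \<psi>])
  have measurable_section: "(\<lambda>x. \<phi> (random_iterate f n \<omega> x) * \<psi> x) \<in> borel_measurable M"
    if [simp]: "\<omega> \<in> space (noise_seq \<epsilon> M)" for \<omega>
    by measurable
  have "(\<integral>\<omega>. (\<integral>x. \<phi> (random_iterate f n \<omega> x) * \<psi> x \<partial>stationary_measure \<epsilon> M f) \<partial>noise_seq \<epsilon> M)
      = (\<integral>\<omega>. \<integral>x. \<phi> (random_iterate f n \<omega> x) * ?g x \<partial>M \<partial>noise_seq \<epsilon> M)"
    by (intro Bochner_Integration.integral_cong[OF refl])
      (simp add: integral_stationary_measure[OF measurable_section] mult.assoc)
  then have "(\<integral>\<omega>. (\<integral>x. \<phi> (random_iterate f n \<omega> x) * \<psi> x \<partial>stationary_measure \<epsilon> M f) \<partial>noise_seq \<epsilon> M)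
      - (\<integral>x. \<phi> x \<partial>stationary_measure \<epsilon> M f) * (\<integral>x. \<psi> x \<partial>stationary_measure \<epsilon> M f)
      = (1 - \<epsilon>) ^ n * ((\<integral>x. ?\<phi>n x * ?g x \<partial>M) - (\<integral>x. ?\<phi>n x * h x \<partial>M) * (\<integral>x. ?g x \<partial>M))"
    by (simp add: integral_stationary_measure random_correlation_eq[OF \<phi> g])
  moreover have "\<bar>(\<integral>x. ?\<phi>n x * ?g x \<partial>M) - (\<integral>x. ?\<phi>n x * h x \<partial>M) * (\<integral>x. ?g x \<partial>M)\<bar>
      \<le> 2 * ?c * L1_norm M ?g"
  proof -
    have a: "\<bar>\<integral>x. ?\<phi>n x * ?g x \<partial>M\<bar> \<le> ?c * L1_norm M ?g"
      by (rule abs_integral_mult_Linf_le[OF Linf_comp_iterate[OF \<phi>] g AE_iterate_le_Linf_norm[OF \<phi>]])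
    have "\<bar>\<integral>x. ?\<phi>n x * h x \<partial>M\<bar> \<le> ?c * L1_norm M h"
      by (rule abs_integral_mult_Linf_le[OF Linf_comp_iterate[OF \<phi>]
        integrable_stationary_density AE_iterate_le_Linf_norm[OF \<phi>]])
    then have "\<bar>\<integral>x. ?\<phi>n x * h x \<partial>M\<bar> \<le> ?c"
      by (simp add: L1_norm_stationary_density)
    moreover have "\<bar>\<integral>x. ?g x \<partial>M\<bar> \<le> L1_norm M ?g"
      unfolding L1_norm_def by (rule integral_abs_bound)
    ultimately have "\<bar>(\<integral>x. ?\<phi>n x * h x \<partial>M) * (\<integral>x. ?g x \<partial>M)\<bar> \<le> ?c * L1_norm M ?g"
      unfolding abs_mult by (intro mult_mono) auto
    with a show ?thesis
      by linarith
  qed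
  ultimately show ?thesis
    using \<epsilon>_less_1 by (simp add: abs_mult mult_left_mono ac_simps)
qed

end

section \<open>Normalized Lebesgue measure on a compact set\<close>

lemma sets_norm_lebesgue: "sets (norm_lebesgue X) = sets (lebesgue_on X)"
  by (simp add: norm_lebesgue_def)

lemma space_norm_lebesgue: "space (norm_lebesgue X) = X"
  by (simp add: norm_lebesgue_def uniform_measure_def space_restrict_space)

lemma prob_space_norm_lebesgue:
  fixes X :: "'a::euclidean_space set"
  assumes "compact X" and "emeasure lebesgue X > 0"
  shows "prob_space (norm_lebesgue X)"
proof -
  have X: "X \<in> lmeasurable"
    using assms(1) by (rule lmeasurable_compact)
  then have "emeasure (lebesgue_on X) X = emeasure lebesgue X"
    by (intro emeasure_restrict_space) auto
  then show ?thesis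
    unfolding norm_lebesgue_def using assms(2) fmeasurableD2[OF X]
    by (intro prob_space_uniform_measure) simp_all
qed

lemma null_sets_norm_lebesgue:
  fixes X :: "'a::euclidean_space set"
  assumes X: "X \<in> sets lebesgue" and N: "N \<in> null_sets lebesgue" "N \<subseteq> X"
  shows "N \<in> null_sets (norm_lebesgue X)"
proof -
  have "N \<in> null_sets (lebesgue_on X)"
    using X N by (subst null_sets_restrict_space) auto
  moreover have "X \<in> sets (lebesgue_on X)" and "X \<inter> N = N"
    using X N(2) by (auto simp: sets_restrict_space_iff)
  ultimately show ?thesis
    by (simp add: null_sets_def norm_lebesgue_def)
qed

text \<open>A Lebesgue measurable set is the union of a Borel set and a null set. The preimage of the former
  is Borel because \<open>f\<close> is, and that of the latter is null because \<open>f\<close> is non-singular.\<close>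

lemma measurable_norm_lebesgue:
  fixes X :: "'a::euclidean_space set"
  assumes X: "compact X" and f: "f \<in> restrict_space borel X \<rightarrow>\<^sub>M restrict_space borel X"
    and ns: "nonsingular (norm_lebesgue X) f"
  shows "f \<in> norm_lebesgue X \<rightarrow>\<^sub>M norm_lebesgue X"
proof (rule measurableI)
  fix x assume "x \<in> space (norm_lebesgue X)"
  then show "f x \<in> space (norm_lebesgue X)"
    using measurable_space[OF f] by (simp add: space_norm_lebesgue space_restrict_space)
next
  have X_leb: "X \<in> sets lebesgue" and X_borel: "X \<in> sets borel"
    using X by (auto simp: compact_imp_closed borel_closed)
  fix A assume "A \<in> sets (norm_lebesgue X)"
  then have A: "A \<in> sets lebesgue" "A \<subseteq> X"
    using X_leb by (auto simp: sets_norm_lebesgue sets_restrict_space_iff)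
  then obtain C T where C: "fsigma C" and T: "T \<in> null_sets lebesgue" and CT: "C \<union> T = A"
    using lebesgue_set_almost_fsigma by metis
  have "C \<in> sets borel"
    using C by induction auto
  then have "C \<in> sets (restrict_space borel X)"
    using CT A X_borel by (auto simp: sets_restrict_space_iff)
  from measurable_sets[OF f this] have "f -` C \<inter> X \<in> sets borel"
    using X_borel by (simp add: space_restrict_space sets_restrict_space_iff)
  then have "f -` C \<inter> X \<in> sets (norm_lebesgue X)"
    using X_leb by (simp add: sets_norm_lebesgue sets_restrict_space_iff)
  moreover have "f -` T \<inter> X \<in> sets (norm_lebesgue X)"
    using ns null_sets_norm_lebesgue[OF X_leb T] CT A(2)
    by (auto simp: nonsingular_def space_norm_lebesgue)
  moreover have "f -` A \<inter> X = (f -` C \<inter> X) \<union> (f -` T \<inter> X)"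
    using CT by auto
  ultimately show "f -` A \<inter> space (norm_lebesgue X) \<in> sets (norm_lebesgue X)"
    by (auto simp: space_norm_lebesgue)
qed

theorem proposition2p1:
  fixes X :: "'a::euclidean_space set"
    and f :: "'a \<Rightarrow> 'a"
    and \<epsilon> :: real
    and \<phi> \<psi> :: "'a \<Rightarrow> real"
    and n :: nat
  defines "m \<equiv> norm_lebesgue X"
  defines "h \<equiv> stationary_density \<epsilon> m f"
  defines "\<mu> \<equiv> stationary_measure \<epsilon> m f"
  assumes "compact X" and "emeasure lebesgue X > 0"
    and "0 < \<epsilon>" and "\<epsilon> < 1"
    and "f \<in> restrict_space borel X \<rightarrow>\<^sub>M restrict_space borel X"
    and "nonsingular m f"
    and "\<phi> \<in> Linf m"
    and "integrable m \<psi>" and "\<psi> \<in> Linf m"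
  shows "\<bar>(\<integral>\<omega>. (\<integral>x. \<phi> (random_iterate f n \<omega> x) * \<psi> x \<partial>\<mu>) \<partial>(noise_seq \<epsilon> m))
            - (\<integral>x. \<phi> x \<partial>\<mu>) * (\<integral>x. \<psi> x \<partial>\<mu>)\<bar>
         \<le> 2 * (1 - \<epsilon>) ^ n * Linf_norm m \<phi> * L1_norm m (\<lambda>x. \<psi> x * h x)"
proof -
  interpret m: prob_space m
    unfolding m_def by (rule prob_space_norm_lebesgue[OF assms(4,5)])
  interpret perturbed_system m f \<epsilon>
  proof
    show "f \<in> m \<rightarrow>\<^sub>M m"
      using measurable_norm_lebesgue[OF assms(4,8)] assms(9) by (simp add: m_def)
  qed (use assms in auto)
  show ?thesis
    unfolding \<mu>_def h_def using assms(10,12) by (rule random_correlation_bound)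
qed

end
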